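(* For every integer $d\ge 2$ there exist a constant $c_d>0$ and a positive integer $k_d$ with the following property. There is an infinite sequence of $(d+1)$-uniform hypergraphs $H_n$, where $H_n$ has $n$ vertices and $n$ tends to infinity, such that every vertex of every $H_n$ belongs to exactly $k_d$ hyperedges, and such that for every injective map $f:V(H_n)\to\mathbb{R}^d$ there is a point $p\in\mathbb{R}^d$ belonging to at least $c_d|E(H_n)|$ of the closed simplices $\mathrm{conv}(f(e))$, $e\in E(H_n)$.
   Context: A hypergraph is $(d+1)$-uniform if every hyperedge is a $(d+1)$-element subset of the vertex set; $\mathrm{conv}(A)$ denotes the convex hull of $A$. The paper adopts the convention that embeddings of vertex sets map the vertices to points in general position. *)

theory Defs
  imports "HOL-Analysis.Analysis"
begin

record 'v hypergraph =
  verts :: "'v set"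
  hyperedges :: "'v set set"

definition uniform_hypergraph :: "nat \<Rightarrow> 'v hypergraph \<Rightarrow> bool" where
  "uniform_hypergraph r H \<longleftrightarrow>
     finite (verts H) \<and> (\<forall>e\<in>hyperedges H. e \<subseteq> verts H \<and> card e = r)"

definition hyperdegree :: "'v hypergraph \<Rightarrow> 'v \<Rightarrow> nat" where
  "hyperdegree H v = card {e \<in> hyperedges H. v \<in> e}"

text \<open>Simplices are counted by hyperedge, so that hyperedges with the same image hull
  (possible when the image is not in general position) count separately.\<close>

definition overlap_count ::
    "'v hypergraph \<Rightarrow> ('v \<Rightarrow> 'a::real_vector) \<Rightarrow> 'a \<Rightarrow> nat" where
  "overlap_count H f p = card {e \<in> hyperedges H. p \<in> convex hull (f ` e)}"

end

theory Submission imports Defs begin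

text \<open>
  Geometry: any \<open>n\<close> points \<open>x i\<close> in \<open>\<real>\<^sup>d\<close> admit a point \<open>z\<close> and boundedly many sets \<open>Y j\<close> of at least
  \<open>c n\<close> indices such that every closed half-space containing \<open>z\<close> contains all points of some \<open>Y j\<close>;
  equivalently, \<open>z\<close> lies in the convex hull of every transversal. This is a weak form of Pach's
  homogeneous selection theorem, with \<open>2 ^ (d + 1)\<close> sets instead of \<open>d + 1\<close>, and its proof is in the
  spirit of the Yao--Yao partition: by induction on the dimension of a space \<open>S\<close> of linear functionals,
  each of which is nonnegative on a positive fraction of the points. A generic \<open>e \<in> S\<close> splits the points
  into two halves; a separation argument yields a direction \<open>v\<close> with \<open>e \<bullet> v > 0\<close> such that both
  halves still satisfy the hypothesis for the functionals vanishing on \<open>v\<close>. A functional \<open>a\<close> is the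
  sum of such a functional and a multiple of \<open>e\<close>, and the sign of the multiple tells which half to use.

  Combinatorics: a random choice of boundedly many neighbours gives sets \<open>T v\<close> of bounded size and
  bounded multiplicity such that for all families of linear-size sets \<open>Y j\<close>, half of the \<open>T v\<close> meet
  every \<open>Y j\<close>. For such \<open>v\<close>, Caratheodory's theorem gives a \<open>(d + 1)\<close>-subset of \<open>T v\<close> whose simplex
  contains \<open>z\<close>, so the \<open>(d + 1)\<close>-subsets of the sets \<open>T v\<close> form a hypergraph of bounded degree with the
  overlap property. Taking many disjoint copies of it and adding edges between the copies of each
  vertex makes it regular.
\<close>

section \<open>Homogeneous families around a point\<close>

definition nonneg_at :: "('i \<Rightarrow> 'a::real_inner) \<Rightarrow> 'i set \<Rightarrow> 'a \<Rightarrow> 'i set" where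
  "nonneg_at x I a = {i \<in> I. 0 \<le> a \<bullet> x i}"

text \<open>Vectors \<open>a\<close> act as linear functionals; the shallow ones, whose closed
  half-space contains few of the points, are what the separation arguments exclude.\<close>

definition shallow :: "'a::real_inner set \<Rightarrow> ('i \<Rightarrow> 'a) \<Rightarrow> 'i set \<Rightarrow> real \<Rightarrow> 'a set" where
  "shallow S x I r = {a \<in> S. real (card (nonneg_at x I a)) < r}"

lemma finite_nonneg_at [simp]: "finite I \<Longrightarrow> finite (nonneg_at x I a)"
  by (simp add: nonneg_at_def)

lemma eventually_inner_perturb_less:
  fixes a w y :: "'a::real_inner"
  assumes "a \<bullet> y < 0"
  shows "\<forall>\<^sub>F t in at_right 0. (a + t *\<^sub>R w) \<bullet> y < 0"
proof (rule order_tendstoD(2))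
  show "((\<lambda>t. (a + t *\<^sub>R w) \<bullet> y) \<longlongrightarrow> (a + 0 *\<^sub>R w) \<bullet> y) (at_right 0)"
    by (intro tendsto_intros)
qed (use assms in simp)

text \<open>The half-spaces are closed, so a point outside has a strictly negative value and keeps
  it under a small perturbation: no point enters.\<close>

lemma shallow_perturb:
  assumes I: "finite I" and S: "subspace S" and a: "a \<in> shallow S x I r" and w: "w \<in> S"
  shows "\<exists>t>0. a + t *\<^sub>R w \<in> shallow S x I r"
proof -
  have "\<forall>\<^sub>F t in at_right 0. \<forall>i\<in>I - nonneg_at x I a. (a + t *\<^sub>R w) \<bullet> x i < 0"
    using I by (intro eventually_ball_finite ballI eventually_inner_perturb_less)
      (auto simp: nonneg_at_def)
  then obtain t where "t > 0" and t: "\<forall>i\<in>I - nonneg_at x I a. (a + t *\<^sub>R w) \<bullet> x i < 0"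
    unfolding eventually_at_right_field by (meson dense)
  have "nonneg_at x I (a + t *\<^sub>R w) \<subseteq> nonneg_at x I a"
    using t by (force simp: nonneg_at_def)
  then have "card (nonneg_at x I (a + t *\<^sub>R w)) \<le> card (nonneg_at x I a)"
    using I by (simp add: card_mono)
  with a w S have "a + t *\<^sub>R w \<in> shallow S x I r"
    by (auto simp: shallow_def subspace_add subspace_scale)
  with \<open>t > 0\<close> show ?thesis by blast
qed

text \<open>One point at a time: a small multiple of a functional nonzero at the new point repairs
  that point and spoils no earlier one.\<close>

lemma exists_generic_in_subspace:
  fixes x :: "'i \<Rightarrow> 'a::real_inner"
  assumes "finite F" "subspace S" "\<forall>i\<in>F. \<exists>a\<in>S. a \<bullet> x i \<noteq> 0"
  shows "\<exists>e\<in>S. \<forall>i\<in>F. e \<bullet> x i \<noteq> 0"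
  using assms(1,3)
proof (induction F)
  case empty
  then show ?case using subspace_0[OF assms(2)] by auto
next
  case (insert k F)
  then obtain e a where e: "e \<in> S" "\<forall>i\<in>F. e \<bullet> x i \<noteq> 0" and a: "a \<in> S" "a \<bullet> x k \<noteq> 0"
    by auto
  show ?case
  proof (cases "e \<bullet> x k = 0")
    case False
    with e show ?thesis by auto
  next
    case True
    have "\<forall>\<^sub>F t in at_right 0. (e + t *\<^sub>R a) \<bullet> x i \<noteq> 0" if "i \<in> F" for i
    proof (rule tendsto_imp_eventually_ne)
      show "((\<lambda>t. (e + t *\<^sub>R a) \<bullet> x i) \<longlongrightarrow> (e + 0 *\<^sub>R a) \<bullet> x i) (at_right 0)"
        by (intro tendsto_intros)
    qed (use e that in simp)
    then have "\<forall>\<^sub>F t in at_right 0. \<forall>i\<in>F. (e + t *\<^sub>R a) \<bullet> x i \<noteq> 0"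
      using insert.hyps by (intro eventually_ball_finite ballI)
    then obtain t where t: "(0::real) < t" "\<forall>i\<in>F. (e + t *\<^sub>R a) \<bullet> x i \<noteq> 0"
      unfolding eventually_at_right_field by (meson dense)
    with True a e have "\<forall>i\<in>insert k F. (e + t *\<^sub>R a) \<bullet> x i \<noteq> 0"
      by (auto simp: inner_add_left)
    then show ?thesis
      using a e assms(2) by (blast intro: subspace_add subspace_scale)
  qed
qed

text \<open>Weak separation is automatically strict here, because \<open>B\<close> is (algebraically) open in \<open>S\<close>.\<close>

lemma strict_separation_from_open_set:
  fixes B :: "'a::euclidean_space set"
  assumes S: "subspace S" and BS: "B \<subseteq> S" and ne: "B \<noteq> {}" and B0: "0 \<notin> convex hull B"
    and op: "\<And>b w. b \<in> B \<Longrightarrow> w \<in> S \<Longrightarrow> \<exists>t>0. b + t *\<^sub>R w \<in> B"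
  obtains v where "v \<in> S" "\<And>b. b \<in> B \<Longrightarrow> b \<bullet> v < 0"
proof -
  obtain a where a: "a \<in> span (convex hull B)" "a \<noteq> 0"
      and sep: "\<And>b. b \<in> convex hull B \<Longrightarrow> 0 \<le> a \<bullet> b"
    using separating_hyperplane_set_0_inspan[of "convex hull B"] ne B0 by auto
  have "convex hull B \<subseteq> S"
    using BS S by (simp add: hull_minimal subspace_imp_convex)
  then have "a \<in> S" using a(1) S span_minimal by blast
  have "b \<bullet> - a < 0" if b: "b \<in> B" for b
  proof (rule ccontr)
    assume "\<not> b \<bullet> - a < 0"
    then have "a \<bullet> b \<le> 0" by (simp add: inner_commute)
    \<comment> \<open>A step against \<open>a\<close> from a point with
      \<open>a \<bullet> b \<le> 0\<close> leaves the half-space that contains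
      \<open>B\<close>.\<close>
    obtain t where "t > 0" and "b + t *\<^sub>R (- a) \<in> B"
      using op[OF b] \<open>a \<in> S\<close> S subspace_neg by blast
    then have "0 \<le> a \<bullet> (b + t *\<^sub>R (- a))" by (meson sep hull_inc)
    then have "t * (a \<bullet> a) \<le> 0" using \<open>a \<bullet> b \<le> 0\<close> by (simp add: inner_diff_right inner_add_right)
    moreover have "a \<bullet> a > 0" using a by simp
    ultimately show False using \<open>t > 0\<close> by (simp add: mult_le_0_iff)
  qed
  moreover have "- a \<in> S" using \<open>a \<in> S\<close> S subspace_neg by blast
  ultimately show thesis using that by blast
qed

text \<open>By Caratheodory, \<open>p\<close> is a convex combination of at most
  \<open>DIM('a) + 1\<close> shallow functionals. Where all of them are negative, so is
  \<open>p\<close>; hence the points counted by \<open>p\<close> are covered by those counted by the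
  summands.\<close>

lemma card_nonneg_at_convex_hull_shallow:
  fixes x :: "'i \<Rightarrow> 'a::euclidean_space" and r :: real
  assumes I: "finite I" and p: "p \<in> convex hull (shallow S x I r)" and r: "r \<ge> 0"
  shows "card (nonneg_at x I p) \<le> (DIM('a) + 1) * r"
proof -
  obtain F u where F: "finite F" "F \<subseteq> shallow S x I r" "card F \<le> DIM('a) + 1"
      and u: "\<forall>a\<in>F. 0 \<le> u a" "sum u F = 1" "(\<Sum>a\<in>F. u a *\<^sub>R a) = p"
    using p unfolding convex_hull_caratheodory by auto
  have "nonneg_at x I p \<subseteq> (\<Union>a\<in>F. nonneg_at x I a)"
  proof
    fix i assume i: "i \<in> nonneg_at x I p"
    show "i \<in> (\<Union>a\<in>F. nonneg_at x I a)"
    proof (rule ccontr)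
      assume "i \<notin> (\<Union>a\<in>F. nonneg_at x I a)"
      with i have neg: "a \<bullet> x i < 0" if "a \<in> F" for a
        using that by (force simp: nonneg_at_def)
      obtain b where b: "b \<in> F" "u b \<noteq> 0"
        using u(2) by (metis sum.neutral zero_neq_one)
      have "(\<Sum>a\<in>F. u a * (a \<bullet> x i)) < (\<Sum>a\<in>F. 0)"
      proof (rule sum_strict_mono_ex1)
        show "\<exists>a\<in>F. u a * (a \<bullet> x i) < 0"
          using b u(1) neg by (intro bexI[of _ b] mult_pos_neg) (auto simp: less_le)
      qed (use F u neg in \<open>auto simp: mult_nonneg_nonpos less_imp_le\<close>)
      moreover have "p \<bullet> x i = (\<Sum>a\<in>F. u a * (a \<bullet> x i))"
        unfolding u(3)[symmetric] by (simp add: inner_sum_left)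
      ultimately show False using i by (simp add: nonneg_at_def)
    qed
  qed
  then have "card (nonneg_at x I p) \<le> card (\<Union>a\<in>F. nonneg_at x I a)"
    using F I by (simp add: card_mono)
  also have "\<dots> \<le> (\<Sum>a\<in>F. card (nonneg_at x I a))"
    by (rule card_UN_le[OF F(1)])
  finally have "real (card (nonneg_at x I p)) \<le> (\<Sum>a\<in>F. real (card (nonneg_at x I a)))"
    by (metis of_nat_le_iff of_nat_sum)
  also have "\<dots> \<le> (\<Sum>a\<in>F. r)"
    using F by (intro sum_mono) (auto simp: shallow_def less_imp_le)
  also have "\<dots> = card F * r" by simp
  also have "\<dots> \<le> (DIM('a) + 1) * r"
    using F(3) r by (intro mult_right_mono) auto
  finally show ?thesis .
qed

text \<open>The direction \<open>v\<close> is strictly negative on the functionals shallow on the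
  upper half and on the negatives of those shallow on the lower half. A functional orthogonal to
  \<open>v\<close> is therefore shallow on neither.\<close>

lemma common_deep_direction:
  fixes x :: "'i \<Rightarrow> 'a::euclidean_space" and r :: real
  assumes I: "finite I" and S: "subspace S" and e: "e \<in> S"
    and r: "r > 0" and zero: "card {i\<in>I. e \<bullet> x i = 0} < r"
    and deep: "\<And>a. a \<in> S \<Longrightarrow> 2 * (DIM('a) + 1) * r < card (nonneg_at x I a)"
  obtains v where "v \<in> S" "e \<bullet> v > 0"
    "\<And>a. a \<in> S \<Longrightarrow> a \<bullet> v = 0 \<Longrightarrow> r \<le> card (nonneg_at x {i\<in>I. 0 \<le> e \<bullet> x i} a)"
    "\<And>a. a \<in> S \<Longrightarrow> a \<bullet> v = 0 \<Longrightarrow> r \<le> card (nonneg_at x {i\<in>I. e \<bullet> x i \<le> 0} a)"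
proof -
  define U where "U = {i\<in>I. 0 \<le> e \<bullet> x i}"
  define L where "L = {i\<in>I. e \<bullet> x i \<le> 0}"
  define A where "A = shallow S x U r"
  define A' where "A' = shallow S (\<lambda>i. - x i) L r"
  have fin: "finite U" "finite L" using I by (auto simp: U_def L_def)
  have neS: "- e \<in> S" using e S subspace_neg by blast
  \<comment> \<open>In either half only the zeros of \<open>e\<close> count for \<open>- e\<close>,
    fewer than \<open>r\<close> in number. So \<open>- e\<close> lies in both sets, which makes them
    nonempty and later gives \<open>e \<bullet> v > 0\<close>.\<close>
  have "nonneg_at x U (- e) = {i\<in>I. e \<bullet> x i = 0}" "nonneg_at (\<lambda>i. - x i) L (- e) = {i\<in>I. e \<bullet> x i = 0}"
    by (auto simp: nonneg_at_def U_def L_def)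
  then have eA: "- e \<in> A" "- e \<in> A'"
    using zero neS by (auto simp: A_def A'_def shallow_def)
  have S_A: "A \<subseteq> S" "A' \<subseteq> S" by (auto simp: A_def A'_def shallow_def)
  have bound: "card (nonneg_at x U p) \<le> (DIM('a) + 1) * r" if "p \<in> convex hull A" for p
    using card_nonneg_at_convex_hull_shallow[of U p S x r] fin that r by (simp add: A_def)
  have bound': "card (nonneg_at (\<lambda>i. - x i) L p) \<le> (DIM('a) + 1) * r" if "p \<in> convex hull A'" for p
    using card_nonneg_at_convex_hull_shallow[of L p S _ r] fin that r by (simp add: A'_def)
  have pos: "0 < (DIM('a) + 1) * r" using r by simp
  have "U = nonneg_at x I e" "L = nonneg_at x I (- e)"
    by (auto simp: U_def L_def nonneg_at_def)
  with deep[OF e] deep[OF neS] pos have big: "(DIM('a) + 1) * r < card U" "(DIM('a) + 1) * r < card L"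
    by (auto simp: algebra_simps)
  have "0 \<notin> convex hull (A \<union> A')"
  proof
    assume in_hull: "0 \<in> convex hull (A \<union> A')"
    have "convex hull (A \<union> A') = convex hull (convex hull A \<union> convex hull A')"
      by (rule trans[OF hull_Un_left hull_Un_right])
    moreover have "\<dots> = {u *\<^sub>R s + u' *\<^sub>R s' | u u' s s'.
        u \<ge> 0 \<and> u' \<ge> 0 \<and> u + u' = 1 \<and> s \<in> convex hull A \<and> s' \<in> convex hull A'}"
      using eA by (intro convex_hull_union_two) auto
    ultimately obtain u u' s s' where u: "u \<ge> 0" "u' \<ge> 0" "u + u' = 1"
        and s: "s \<in> convex hull A" "s' \<in> convex hull A'" and eq: "0 = u *\<^sub>R s + u' *\<^sub>R s'"
      using in_hull by auto
    \<comment> \<open>The zero functional counts every point of its half, more than the Caratheodory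
      bound allows. So both coefficients are positive and \<open>s'\<close> is a negative multiple
      of \<open>s\<close>.\<close>
    have "s \<noteq> 0"
      using bound[OF s(1)] big by (auto simp: nonneg_at_def)
    have "s' \<noteq> 0"
      using bound'[OF s(2)] big by (auto simp: nonneg_at_def)
    have "u > 0" "u' > 0"
      using u eq \<open>s \<noteq> 0\<close> \<open>s' \<noteq> 0\<close> by (auto simp: less_le)
    have "s \<in> S" 
      using s(1) hull_minimal[OF S_A(1), of convex] subspace_imp_convex[OF S] by blast
    \<comment> \<open>Where \<open>s\<close> is nonnegative, \<open>s'\<close> is nonpositive. So
      the bound for \<open>A'\<close> limits what \<open>s\<close> counts in \<open>L\<close>, the
      bound for \<open>A\<close> what it counts in \<open>U\<close>, and together they contradict
      \<open>deep\<close>.\<close>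
    have "nonneg_at x L s \<subseteq> nonneg_at (\<lambda>i. - x i) L s'"
    proof
      fix i assume i: "i \<in> nonneg_at x L s"
      have "u * (s \<bullet> x i) + u' * (s' \<bullet> x i) = 0"
        using arg_cong[OF eq, of "\<lambda>y. y \<bullet> x i"] by (simp add: inner_add_left)
      moreover have "0 \<le> u * (s \<bullet> x i)" using i u by (simp add: nonneg_at_def)
      ultimately have "u' * (s' \<bullet> x i) \<le> 0" by linarith
      then show "i \<in> nonneg_at (\<lambda>i. - x i) L s'"
        using i \<open>u' > 0\<close> by (simp add: nonneg_at_def mult_le_0_iff)
    qed
    then have "card (nonneg_at x L s) \<le> card (nonneg_at (\<lambda>i. - x i) L s')"
      using fin by (simp add: card_mono)
    moreover have "nonneg_at x I s \<subseteq> nonneg_at x U s \<union> nonneg_at x L s"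
      by (auto simp: nonneg_at_def U_def L_def)
    then have "card (nonneg_at x I s) \<le> card (nonneg_at x U s \<union> nonneg_at x L s)"
      using fin by (simp add: card_mono)
    then have "card (nonneg_at x I s) \<le> card (nonneg_at x U s) + card (nonneg_at x L s)"
      using card_Un_le order_trans by blast
    ultimately show False
      using bound[OF s(1)] bound'[OF s(2)] deep[OF \<open>s \<in> S\<close>] by (simp add: algebra_simps)
  qed
  moreover have "\<exists>t>0. b + t *\<^sub>R w \<in> A \<union> A'" if "b \<in> A \<union> A'" "w \<in> S" for b w
    using that shallow_perturb[OF fin(1) S, of b x r w] shallow_perturb[OF fin(2) S, of b _ r w]
    unfolding A_def A'_def by blast
  ultimately obtain v where v: "v \<in> S" "\<And>b. b \<in> A \<union> A' \<Longrightarrow> b \<bullet> v < 0"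
    using strict_separation_from_open_set[of S "A \<union> A'"] S S_A eA by blast
  show thesis
  proof
    show "v \<in> S" by fact
    show "e \<bullet> v > 0" using v(2)[of "- e"] eA by simp
  next
    fix a assume a: "a \<in> S" "a \<bullet> v = 0"
    then have "a \<notin> A" using v(2)[of a] by auto
    then show "r \<le> card (nonneg_at x {i\<in>I. 0 \<le> e \<bullet> x i} a)"
      using a by (simp add: A_def shallow_def U_def)
    have "- a \<notin> A'" using v(2)[of "- a"] a by auto
    moreover have "- a \<in> S" using a S subspace_neg by blast
    moreover have "nonneg_at (\<lambda>i. - x i) L (- a) = nonneg_at x L a" by (simp add: nonneg_at_def)
    ultimately show "r \<le> card (nonneg_at x {i\<in>I. e \<bullet> x i \<le> 0} a)"
      by (simp add: A'_def shallow_def L_def)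
  qed
qed

text \<open>Each induction step lowers the dimension of \<open>S\<close>, replaces
  \<open>\<beta>\<close> by a smaller depth and doubles the number of sets. As \<open>c\<close> is
  fixed before \<open>S\<close>, \<open>I\<close> and \<open>x\<close>, it is uniform over all
  configurations.\<close>

lemma deep_imp_homogeneous_sets:
  "\<beta> > (0::real) \<Longrightarrow> \<exists>c>0::real. \<forall>(S::'a::euclidean_space set) (I::'i set) x.
     subspace S \<longrightarrow> dim S \<le> m \<longrightarrow> finite I \<longrightarrow>
     (\<forall>a\<in>S. \<beta> * card I \<le> card (nonneg_at x I a)) \<longrightarrow>
     (\<exists>Y::nat \<Rightarrow> 'i set. (\<forall>j<2 ^ m. Y j \<subseteq> I \<and> c * card I \<le> card (Y j)) \<and>
          (\<forall>a\<in>S. \<exists>j<2 ^ m. \<forall>i\<in>Y j. 0 \<le> a \<bullet> x i))"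
proof (induction m arbitrary: \<beta>)
  case 0
  show ?case
  proof (intro exI[of _ "1::real"] conjI allI impI)
    fix S :: "'a set" and I :: "'i set" and x :: "'i \<Rightarrow> 'a"
    assume "dim S \<le> 0"
    then have "S \<subseteq> {0}" by (simp add: dim_eq_0)
    then show "\<exists>Y::nat \<Rightarrow> 'i set. (\<forall>j<2 ^ 0. Y j \<subseteq> I \<and> 1 * real (card I) \<le> card (Y j)) \<and>
          (\<forall>a\<in>S. \<exists>j<2 ^ 0. \<forall>i\<in>Y j. 0 \<le> a \<bullet> x i)"
      by (intro exI[of _ "\<lambda>_::nat. I"]) auto
  qed simp
next
  case (Suc m)
  \<comment> \<open>Then \<open>2 * (DIM('a) + 1) * \<gamma> = \<beta> / 2\<close>, which leaves the
    strict slack that \<open>common_deep_direction\<close> requires.\<close>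
  define \<gamma> where "\<gamma> = \<beta> / (4 * (DIM('a) + 1))"
  have "\<gamma> > 0" using Suc.prems by (simp add: \<gamma>_def)
  from Suc.IH[OF this] obtain c :: real where "c > 0" and IH: "\<And>(S::'a set) (I::'i set) x.
     subspace S \<Longrightarrow> dim S \<le> m \<Longrightarrow> finite I \<Longrightarrow>
     (\<forall>a\<in>S. \<gamma> * card I \<le> card (nonneg_at x I a)) \<Longrightarrow>
     (\<exists>Y::nat \<Rightarrow> 'i set. (\<forall>j<2 ^ m. Y j \<subseteq> I \<and> c * card I \<le> card (Y j)) \<and>
          (\<forall>a\<in>S. \<exists>j<2 ^ m. \<forall>i\<in>Y j. 0 \<le> a \<bullet> x i))" by metis
  \<comment> \<open>\<open>\<gamma>\<close> pays for the case of many degenerate points,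
    \<open>c * \<beta>\<close> for the sets found inside a half, as each half has at least
    \<open>\<beta> * card I\<close> indices.\<close>
  define c' where "c' = min \<gamma> (c * \<beta>)"
  show ?case
  proof (intro exI[of _ c'] conjI allI impI)
    show "c' > 0" using \<open>\<gamma> > 0\<close> \<open>c > 0\<close> Suc.prems by (simp add: c'_def)
    fix S :: "'a set" and I :: "'i set" and x :: "'i \<Rightarrow> 'a"
    assume S: "subspace S" "dim S \<le> Suc m" and I: "finite I"
      and deep: "\<forall>a\<in>S. \<beta> * card I \<le> card (nonneg_at x I a)"
    define Z where "Z = {i\<in>I. \<forall>a\<in>S. a \<bullet> x i = 0}"
    show "\<exists>Y::nat \<Rightarrow> 'i set. (\<forall>j<2 ^ Suc m. Y j \<subseteq> I \<and> c' * card I \<le> card (Y j)) \<and>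
          (\<forall>a\<in>S. \<exists>j<2 ^ Suc m. \<forall>i\<in>Y j. 0 \<le> a \<bullet> x i)"
    \<comment> \<open>If many points are annihilated by all of \<open>S\<close>, they serve every
      functional. Otherwise a generic \<open>e\<close> vanishes only at those few points.\<close>
    proof (cases "\<gamma> * card I \<le> card Z")
      case True
      moreover have "c' * card I \<le> \<gamma> * card I" by (simp add: c'_def mult_right_mono)
      ultimately have "c' * card I \<le> card Z" by linarith
      moreover have "Z \<subseteq> I" "\<forall>a\<in>S. \<forall>i\<in>Z. 0 \<le> a \<bullet> x i" by (auto simp: Z_def)
      moreover have "(0::nat) < 2 ^ Suc m" by simp
      ultimately show ?thesis by (intro exI[of _ "\<lambda>_::nat. Z"]) blast
    next
      case False
      then have "I \<noteq> {}" by auto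
      then have n: "card I > 0" using I by (simp add: card_gt_0_iff)
      obtain e where e: "e \<in> S" "\<forall>i\<in>I - Z. e \<bullet> x i \<noteq> 0"
        using exists_generic_in_subspace[of "I - Z" S x] I S by (auto simp: Z_def)
      then have "{i\<in>I. e \<bullet> x i = 0} = Z" by (auto simp: Z_def)
      with False have zero: "card {i\<in>I. e \<bullet> x i = 0} < \<gamma> * card I" by simp
      define U where "U = {i\<in>I. 0 \<le> e \<bullet> x i}"
      define L where "L = {i\<in>I. e \<bullet> x i \<le> 0}"
      have "2 * (DIM('a) + 1) * (\<gamma> * card I) = \<beta> * card I / 2"
        by (simp add: \<gamma>_def field_simps)
      also have "\<dots> < \<beta> * card I" using n Suc.prems by simp
      finally have "2 * (DIM('a) + 1) * (\<gamma> * card I) < card (nonneg_at x I a)" if "a \<in> S" for a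
        using deep that by force
      moreover have "\<gamma> * card I > 0" using n \<open>\<gamma> > 0\<close> by simp
      ultimately obtain v where v: "v \<in> S" "e \<bullet> v > 0"
          "\<And>a. a \<in> S \<Longrightarrow> a \<bullet> v = 0 \<Longrightarrow> \<gamma> * card I \<le> card (nonneg_at x U a)"
          "\<And>a. a \<in> S \<Longrightarrow> a \<bullet> v = 0 \<Longrightarrow> \<gamma> * card I \<le> card (nonneg_at x L a)"
        using common_deep_direction[OF I S(1) e(1), of "\<gamma> * card I" x] zero
        unfolding U_def L_def by blast
      define S' where "S' = {a\<in>S. a \<bullet> v = 0}"
      have S': "subspace S'"
        using S(1) unfolding S'_def subspace_def by (auto simp: inner_add_left)
      have "v \<notin> S'" using v(2) by (auto simp: S'_def)
      moreover have "S' \<subseteq> S" by (auto simp: S'_def)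
      ultimately have "S' \<subset> S" using v(1) by blast
      then have "span S' \<subset> span S" using S(1) S' span_eq_iff by metis
      then have dim: "dim S' \<le> m" using dim_psubset[of S' S] S(2) by simp
      have fin: "finite U" "finite L" "card U \<le> card I" "card L \<le> card I"
        using I by (auto simp: U_def L_def intro: card_mono)
      have "\<forall>a\<in>S'. \<gamma> * card U \<le> card (nonneg_at x U a)" "\<forall>a\<in>S'. \<gamma> * card L \<le> card (nonneg_at x L a)"
        using v(3,4) fin(3,4) \<open>\<gamma> > 0\<close> unfolding S'_def
        by (smt (verit, ccfv_SIG) mem_Collect_eq mult_left_mono of_nat_mono)+
      then obtain Y Y' :: "nat \<Rightarrow> 'i set" where
          Y: "\<forall>j<2 ^ m. Y j \<subseteq> U \<and> c * card U \<le> card (Y j)" "\<forall>a\<in>S'. \<exists>j<2 ^ m. \<forall>i\<in>Y j. 0 \<le> a \<bullet> x i"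
        and Y': "\<forall>j<2 ^ m. Y' j \<subseteq> L \<and> c * card L \<le> card (Y' j)" "\<forall>a\<in>S'. \<exists>j<2 ^ m. \<forall>i\<in>Y' j. 0 \<le> a \<bullet> x i"
        using IH[OF S' dim fin(1), of x] IH[OF S' dim fin(2), of x] by auto
      have "- e \<in> S" using e(1) S(1) subspace_neg by blast
      moreover have "U = nonneg_at x I e" "L = nonneg_at x I (- e)"
        by (auto simp: U_def L_def nonneg_at_def)
      ultimately have "\<beta> * card I \<le> card U" "\<beta> * card I \<le> card L" using deep e(1) by auto
      then have "c * (\<beta> * card I) \<le> c * card U" "c * (\<beta> * card I) \<le> c * card L"
        using \<open>c > 0\<close> by simp_all
      moreover have "c' * card I \<le> c * \<beta> * card I" by (simp add: c'_def mult_right_mono)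
      ultimately have size: "c' * card I \<le> c * card U" "c' * card I \<le> c * card L"
        by (simp_all add: mult.assoc)
      define W where "W j = (if j < 2 ^ m then Y j else Y' (j - 2 ^ m))" for j
      have "W j \<subseteq> I \<and> c' * card I \<le> card (W j)" if "j < 2 ^ Suc m" for j
      proof (cases "j < 2 ^ m")
        case True
        then have "Y j \<subseteq> U" "c * card U \<le> card (Y j)" using Y by auto
        then show ?thesis using True size by (auto simp: W_def U_def)
      next
        case False
        with that have "j - 2 ^ m < 2 ^ m" by auto
        then have "Y' (j - 2 ^ m) \<subseteq> L" "c * card L \<le> card (Y' (j - 2 ^ m))" using Y' by auto
        then show ?thesis using False size by (auto simp: W_def L_def)
      qed
      moreover have "\<exists>j<2 ^ Suc m. \<forall>i\<in>W j. 0 \<le> a \<bullet> x i" if a: "a \<in> S" for a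
      proof -
        \<comment> \<open>With this \<open>t\<close>, \<open>a - t *\<^sub>R e\<close> vanishes on
          \<open>v\<close> and so lies in \<open>S'\<close>. The term
          \<open>t * (e \<bullet> x i)\<close> is nonnegative on the upper half if
          \<open>t \<ge> 0\<close>, on the lower half if \<open>t < 0\<close>.\<close>
        define t where "t = (a \<bullet> v) / (e \<bullet> v)"
        define a' where "a' = a - t *\<^sub>R e"
        have "a' \<in> S'"
          using a e(1) S(1) v(2) by (simp add: S'_def a'_def t_def inner_diff_left subspace_diff subspace_scale)
        then obtain j k where j: "j < 2 ^ m" "\<forall>i\<in>Y j. 0 \<le> a' \<bullet> x i"
            and k: "k < 2 ^ m" "\<forall>i\<in>Y' k. 0 \<le> a' \<bullet> x i"
          using Y(2) Y'(2) by meson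
        have split: "a \<bullet> x i = a' \<bullet> x i + t * (e \<bullet> x i)" for i
          by (simp add: a'_def inner_diff_left)
        show ?thesis
        proof (cases "t \<ge> 0")
          case True
          have "0 \<le> a \<bullet> x i" if "i \<in> Y j" for i
          proof -
            have "0 \<le> e \<bullet> x i" using that j Y(1) by (auto simp: U_def)
            then show ?thesis using that j True unfolding split by simp
          qed
          then show ?thesis using j by (intro exI[of _ j]) (auto simp: W_def)
        next
          case False
          have "0 \<le> a \<bullet> x i" if "i \<in> Y' k" for i
          proof -
            have "e \<bullet> x i \<le> 0" using that k Y'(1) by (auto simp: L_def)
            then have "0 \<le> t * (e \<bullet> x i)" using False by (simp add: mult_nonpos_nonpos)
            then show ?thesis using that k unfolding split by auto
          qed
          then show ?thesis using k by (intro exI[of _ "k + 2 ^ m"]) (auto simp: W_def)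
        qed
      qed
      ultimately show ?thesis by (intro exI[of _ W]) blast
    qed
  qed
qed

text \<open>Lifting the points to height 1 in one more dimension turns affine functionals into
  linear ones. A first separation, in effect the centerpoint theorem with a weaker constant, gives
  \<open>z\<close> such that all functionals vanishing at its lift are deep;
  \<open>deep_imp_homogeneous_sets\<close> applies to these.\<close>

lemma homogeneous_center:
  "\<exists>(K::nat) (c::real). c > 0 \<and> (\<forall>(I::'i set) (x :: 'i \<Rightarrow> 'a::euclidean_space).
     finite I \<longrightarrow> (\<exists>z Y. (\<forall>j<K. Y j \<subseteq> I \<and> c * card I \<le> card (Y j)) \<and>
       (\<forall>y. (\<forall>j<K. y j \<in> Y j) \<longrightarrow> z \<in> convex hull (x ` y ` {..<K}))))"
proof -
  define D where "D = real (DIM('a \<times> real) + 1)"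
  have D: "D > 0" by (simp add: D_def)
  obtain c :: real where "c > 0" and c: "\<And>(S::('a \<times> real) set) (I::'i set) x.
     subspace S \<Longrightarrow> finite I \<Longrightarrow>
     (\<forall>a\<in>S. (1 / (2 * D)) * card I \<le> card (nonneg_at x I a)) \<Longrightarrow>
     (\<exists>Y::nat \<Rightarrow> 'i set. (\<forall>j<2 ^ DIM('a \<times> real). Y j \<subseteq> I \<and> c * card I \<le> card (Y j)) \<and>
          (\<forall>a\<in>S. \<exists>j<2 ^ DIM('a \<times> real). \<forall>i\<in>Y j. 0 \<le> a \<bullet> x i))"
    using deep_imp_homogeneous_sets[of "1 / (2 * D)" "DIM('a \<times> real)", where 'a="'a \<times> real" and 'i='i]
      D dim_subset_UNIV[where 'a="'a \<times> real"] by auto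
  define K :: nat where "K = 2 ^ DIM('a \<times> real)"
  have "\<exists>z Y. (\<forall>j<K. Y j \<subseteq> I \<and> c * card I \<le> card (Y j)) \<and>
       (\<forall>y. (\<forall>j<K. y j \<in> Y j) \<longrightarrow> z \<in> convex hull (x ` y ` {..<K}))"
    if I: "finite I" for I :: "'i set" and x :: "'i \<Rightarrow> 'a"
  proof (cases "I = {}")
    case True
    \<comment> \<open>Without points all \<open>Y j\<close> are empty, and since
      \<open>K > 0\<close> there is no transversal.\<close>
    moreover have "K > 0" by (simp add: K_def)
    ultimately show ?thesis by (intro exI[of _ 0] exI[of _ "\<lambda>_. {}"]) auto
  next
    case False
    with I have n: "card I > 0" by (simp add: card_gt_0_iff)
    define x' where "x' i = (x i, 1::real)" for i
    \<comment> \<open>A functional in the hull of the shallow ones then counts at most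
      \<open>D * r\<close>, half of the points, while 0 counts them all.\<close>
    define r where "r = card I / (2 * D)"
    have r: "r > 0" using n D by (simp add: r_def)
    define A where "A = shallow UNIV x' I r"
    \<comment> \<open>This functional is -1 at every lifted point. It forces the last coordinate
      \<open>\<tau>\<close> of \<open>v\<close> to be positive, so \<open>v\<close> can be scaled to
      a lifted point.\<close>
    have e: "(0, - 1) \<in> A" using r by (auto simp: A_def shallow_def nonneg_at_def x'_def)
    have "0 \<notin> convex hull A"
    proof
      assume "0 \<in> convex hull A"
      from card_nonneg_at_convex_hull_shallow[OF I this[unfolded A_def]] r
      have "card I \<le> D * r" by (simp add: nonneg_at_def D_def)
      then show False using n D by (simp add: r_def)
    qed
    then obtain v where v: "\<And>a. a \<in> A \<Longrightarrow> a \<bullet> v < 0"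
      using strict_separation_from_open_set[OF subspace_UNIV, of A] e
        shallow_perturb[OF I subspace_UNIV, of _ x' r] unfolding A_def by auto
    obtain z\<^sub>0 \<tau> where z0: "v = (z\<^sub>0, \<tau>)" by (cases v)
    have "\<tau> > 0" using v[OF e] by (simp add: z0)
    define z where "z = z\<^sub>0 /\<^sub>R \<tau>"
    define S where "S = {a. a \<bullet> v = 0}"
    have "subspace S" unfolding S_def subspace_def by (auto simp: inner_add_left)
    moreover have "\<forall>a\<in>S. (1 / (2 * D)) * card I \<le> card (nonneg_at x' I a)"
    proof
      fix a assume "a \<in> S"
      then have "a \<notin> A" using v[of a] by (auto simp: S_def)
      then show "(1 / (2 * D)) * card I \<le> card (nonneg_at x' I a)"
        by (simp add: A_def shallow_def r_def)
    qed
    ultimately obtain Y where Y: "\<forall>j<K. Y j \<subseteq> I \<and> c * card I \<le> card (Y j)"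
        and hom: "\<forall>a\<in>S. \<exists>j<K. \<forall>i\<in>Y j. 0 \<le> a \<bullet> x' i"
      using c[of S I x'] I unfolding K_def by auto
    have "z \<in> convex hull (x ` y ` {..<K})" if y: "\<forall>j<K. y j \<in> Y j" for y
    proof (rule ccontr)
      assume "z \<notin> convex hull (x ` y ` {..<K})"
      moreover have "closed (convex hull (x ` y ` {..<K}))"
        by (intro compact_imp_closed compact_convex_hull finite_imp_compact) auto
      ultimately obtain a b where ab: "a \<bullet> z < b" "\<forall>w\<in>convex hull (x ` y ` {..<K}). b < a \<bullet> w"
        using separating_hyperplane_closed_point[OF convex_convex_hull] by metis
      \<comment> \<open>At the lift of a point \<open>w\<close> its value is
        \<open>a \<bullet> z - a \<bullet> w\<close>: zero at \<open>z\<close>, negative on the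
        whole transversal.\<close>
      define a' where "a' = (- a, a \<bullet> z)"
      have "a' \<in> S" using \<open>\<tau> > 0\<close> by (simp add: S_def a'_def z0 z_def)
      then obtain j where j: "j < K" "\<forall>i\<in>Y j. 0 \<le> a' \<bullet> x' i" using hom by blast
      then have "0 \<le> a' \<bullet> x' (y j)" using y by blast
      moreover have "b < a \<bullet> x (y j)" using ab(2) j(1) by (auto intro: hull_inc)
      ultimately show False using ab(1) by (simp add: a'_def x'_def)
    qed
    with Y show ?thesis by blast
  qed
  with \<open>c > 0\<close> show ?thesis by blast
qed

section \<open>Sparse set systems hitting all large sets\<close>

text \<open>\<open>g (v, l)\<close> is the \<open>l\<close>-th of \<open>D\<close> random neighbours
  of \<open>v\<close>. The proof is a count: for each pair, the maps avoiding \<open>Y\<close> from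
  \<open>A\<close> form less than a \<open>(1 / 4) ^ n\<close> fraction, and there are at most
  \<open>4 ^ n\<close> pairs.\<close>

lemma exists_mixing_maps:
  fixes \<epsilon> :: real
  assumes \<epsilon>: "0 < \<epsilon>" "\<epsilon> \<le> 1"
  shows "\<exists>D::nat. \<forall>n::nat. n > 0 \<longrightarrow> (\<exists>g :: nat \<times> nat \<Rightarrow> nat.
    g ` ({..<n} \<times> {..<D}) \<subseteq> {..<n} \<and>
    (\<forall>A Y. A \<subseteq> {..<n} \<longrightarrow> Y \<subseteq> {..<n} \<longrightarrow> \<epsilon> * n \<le> card A \<longrightarrow> \<epsilon> * n \<le> card Y \<longrightarrow>
      g ` (A \<times> {..<D}) \<inter> Y \<noteq> {}))"
proof -
  \<comment> \<open>\<open>m\<close> random choices all miss a set of density \<epsilon> with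
    probability below 1/4, and \<open>D\<close> is so large that the vertices of \<open>A\<close>
    make at least \<open>n * m\<close> choices.\<close>
  obtain m where m: "(1 - \<epsilon>) ^ m < 1 / 4"
    using real_arch_pow_inv[of "1 / 4" "1 - \<epsilon>"] \<epsilon> by auto
  obtain D :: nat where D: "m \<le> \<epsilon> * D"
    using reals_Archimedean3[OF \<epsilon>(1)] by (metis less_imp_le mult.commute)
  have "\<exists>g. g ` ({..<n} \<times> {..<D}) \<subseteq> {..<n} \<and>
    (\<forall>A Y. A \<subseteq> {..<n} \<longrightarrow> Y \<subseteq> {..<n} \<longrightarrow> \<epsilon> * n \<le> card A \<longrightarrow> \<epsilon> * n \<le> card Y \<longrightarrow>
      g ` (A \<times> {..<D}) \<inter> Y \<noteq> {})" if n: "n > 0" for n :: nat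
  proof -
    define F where "F = (\<Pi>\<^sub>E _\<in>{..<n} \<times> {..<D}. {..<n})"
    define P where "P = {A. A \<subseteq> {..<n} \<and> \<epsilon> * n \<le> card A}"
    define bad where "bad A Y = (\<Pi>\<^sub>E p\<in>{..<n} \<times> {..<D}. if fst p \<in> A then {..<n} - Y else {..<n})" for A Y
    have P: "P \<subseteq> Pow {..<n}" by (auto simp: P_def)
    have cF: "card F = n ^ (n * D)" by (simp add: F_def card_PiE)
    have cbad: "card (bad A Y) < (1 / 4) ^ n * real (n ^ (n * D))"
      if "A \<in> P" "Y \<in> P" for A Y
    proof -
      have A: "A \<subseteq> {..<n}" "\<epsilon> * n \<le> card A" and Y: "Y \<subseteq> {..<n}" "\<epsilon> * n \<le> card Y"
        using that by (auto simp: P_def)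
      have "card (bad A Y) = (\<Prod>p\<in>{..<n} \<times> {..<D}. if fst p \<in> A then card ({..<n} - Y) else n)"
        unfolding bad_def by (subst card_PiE) (auto intro!: prod.cong)
      also have "\<dots> = (\<Prod>p\<in>A \<times> {..<D}. card ({..<n} - Y)) * (\<Prod>p\<in>({..<n} - A) \<times> {..<D}. n)"
      proof -
        have split: "{..<n} \<times> {..<D} = A \<times> {..<D} \<union> ({..<n} - A) \<times> {..<D}" using A by auto
        show ?thesis
          unfolding split using finite_subset[OF A(1)]
          by (subst prod.union_disjoint)
            (auto simp del: prod_constant intro!: arg_cong2[of _ _ _ _ "(*)"] prod.cong)
      qed
      also have "\<dots> = (n - card Y) ^ (card A * D) * n ^ ((n - card A) * D)"
        using A Y by (simp add: card_cartesian_product card_Diff_subset finite_subset[OF _ finite_lessThan])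
      finally have eq: "card (bad A Y) = (n - card Y) ^ (card A * D) * n ^ ((n - card A) * D)" .
      have le: "card A \<le> n" "card Y \<le> n" using A Y card_mono[of "{..<n}"] by auto
      have "real (n - card Y) \<le> (1 - \<epsilon>) * n" using Y le by (simp add: algebra_simps)
      then have "real (card (bad A Y)) \<le> ((1 - \<epsilon>) * n) ^ (card A * D) * n ^ ((n - card A) * D)"
        unfolding eq by (simp add: mult_right_mono power_mono)
      also have "\<dots> = (1 - \<epsilon>) ^ (card A * D) * n ^ (card A * D + (n - card A) * D)"
        by (simp add: power_mult_distrib power_add)
      also have "card A * D + (n - card A) * D = n * D"
        using le by (simp add: add_mult_distrib[symmetric])
      finally have 1: "real (card (bad A Y)) \<le> (1 - \<epsilon>) ^ (card A * D) * real (n ^ (n * D))" by simp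
      have "real (n * m) \<le> n * (\<epsilon> * D)" using D by (simp add: mult_left_mono)
      also have "\<dots> \<le> real (card A * D)" 
        using mult_right_mono[OF A(2), of "real D"] by (simp add: mult_ac)
      finally have "n * m \<le> card A * D" by linarith
      then have "(1 - \<epsilon>) ^ (card A * D) \<le> (1 - \<epsilon>) ^ (n * m)"
        using \<epsilon> by (intro power_decreasing) auto
      also have "\<dots> = ((1 - \<epsilon>) ^ m) ^ n" by (simp add: power_mult[symmetric] mult.commute)
      also have "\<dots> < (1 / 4) ^ n"
        using m n \<epsilon> by (intro power_strict_mono) auto
      finally have 2: "(1 - \<epsilon>) ^ (card A * D) < (1 / 4) ^ n" .
      have "(1 - \<epsilon>) ^ (card A * D) * real (n ^ (n * D)) < (1 / 4) ^ n * real (n ^ (n * D))"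
        using 2 n by (intro mult_strict_right_mono) auto
      with 1 show ?thesis by linarith
    qed
    have "F \<noteq> (\<Union>(A, Y)\<in>P \<times> P. bad A Y)"
    proof
      assume F: "F = (\<Union>(A, Y)\<in>P \<times> P. bad A Y)"
      have fP: "finite (P \<times> P)" using P finite_subset by blast
      have "{..<n} \<in> P" using \<epsilon> by (simp add: P_def mult_left_le_one_le)
      then have ne: "P \<times> P \<noteq> {}" by auto
      have "card F \<le> (\<Sum>(A, Y)\<in>P \<times> P. card (bad A Y))"
        unfolding F using card_UN_le[OF fP, of "\<lambda>(A, Y). bad A Y"] by (simp add: case_prod_unfold)
      then have "real (card F) \<le> (\<Sum>(A, Y)\<in>P \<times> P. real (card (bad A Y)))"
        by (simp add: case_prod_unfold flip: of_nat_sum)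
      also have "\<dots> < (\<Sum>(A, Y)\<in>P \<times> P. (1 / 4) ^ n * real (n ^ (n * D)))"
        using cbad fP ne by (intro sum_strict_mono) auto
      also have "\<dots> = (card P * card P) * ((1 / 4) ^ n * real (n ^ (n * D)))"
        by (simp add: case_prod_unfold card_cartesian_product)
      also have "\<dots> \<le> (2 ^ n * 2 ^ n) * ((1 / 4) ^ n * real (n ^ (n * D)))"
      proof -
        have "card P \<le> 2 ^ n" using card_mono[of "Pow {..<n}" P] P by (simp add: card_Pow)
        then have "card P * card P \<le> 2 ^ n * 2 ^ n" by (intro mult_mono) auto
        then have "real (card P * card P) \<le> real (2 ^ n * 2 ^ n)" using of_nat_le_iff by blast
        then show ?thesis by (intro mult_right_mono) auto
      qed
      also have "\<dots> = real (n ^ (n * D))"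
        by (simp add: power_mult_distrib[symmetric] mult.assoc[symmetric])
      finally show False by (simp add: cF)
    qed
    moreover have "(\<Union>(A, Y)\<in>P \<times> P. bad A Y) \<subseteq> F"
      by (force simp: bad_def F_def PiE_iff split: if_splits)
    ultimately obtain g where "g \<in> F" "g \<notin> (\<Union>(A, Y)\<in>P \<times> P. bad A Y)" by blast
    then have g: "g \<in> F" "\<And>A Y. A \<in> P \<Longrightarrow> Y \<in> P \<Longrightarrow> g \<notin> bad A Y" by auto
    have "g ` (A \<times> {..<D}) \<inter> Y \<noteq> {}" if "A \<in> P" "Y \<in> P" for A Y
    proof
      assume empty: "g ` (A \<times> {..<D}) \<inter> Y = {}"
      have "g \<in> bad A Y"
        unfolding bad_def
      proof (rule PiE_I)
        fix p assume p: "p \<in> {..<n} \<times> {..<D}"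
        then have "g p \<in> {..<n}" using g(1) by (auto simp: F_def)
        moreover have "g p \<notin> Y" if "fst p \<in> A"
          using empty that p by (cases p) auto
        ultimately show "g p \<in> (if fst p \<in> A then {..<n} - Y else {..<n})" by auto
      qed (use g(1) in \<open>auto simp: F_def PiE_def extensional_def\<close>)
      then show False using g(2) that by blast
    qed
    moreover have "g ` ({..<n} \<times> {..<D}) \<subseteq> {..<n}" using g(1) by (auto simp: F_def)
    ultimately show ?thesis by (intro exI[of _ g]) (auto simp: P_def)
  qed
  then show ?thesis by blast
qed

text \<open>\<open>T v\<close> consists of the \<open>D\<close> neighbours of \<open>v\<close>
  without the overloaded vertices \<open>R\<close>, which bounds the multiplicity. By double
  counting \<open>R\<close> is small, so every \<open>Y j\<close> stays large without it, and mixing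
  leaves few \<open>v\<close> that miss it.\<close>

lemma exists_hitting_neighbourhoods:
  fixes c :: real and J :: nat
  assumes c: "0 < c" "c \<le> 1"
  shows "\<exists>D M::nat. M > 0 \<and> (\<forall>n::nat. n > 0 \<longrightarrow> (\<exists>T :: nat \<Rightarrow> nat set.
    (\<forall>v<n. T v \<subseteq> {..<n} \<and> card (T v) \<le> D) \<and> (\<forall>u. card {v\<in>{..<n}. u \<in> T v} \<le> M) \<and>
    (\<forall>Y. (\<forall>j<J. Y j \<subseteq> {..<n} \<and> c * n \<le> card (Y j)) \<longrightarrow>
       n \<le> 2 * card {v\<in>{..<n}. \<forall>j<J. T v \<inter> Y j \<noteq> {}})))"
proof -
  \<comment> \<open>\<open>c / 2\<close> is the density left in \<open>Y j\<close> after removing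
    \<open>R\<close>; the second term makes the \<open>J\<close> exceptional sets cover at most half
    of the vertices, with \<open>J + 1\<close> avoiding a zero denominator.\<close>
  define \<epsilon> where "\<epsilon> = min (c / 2) (1 / (2 * (J + 1)))"
  have \<epsilon>: "0 < \<epsilon>" "\<epsilon> \<le> 1" "\<epsilon> \<le> c / 2" "J * \<epsilon> \<le> 1 / 2"
  proof -
    have "J * \<epsilon> \<le> J * (1 / (2 * (J + 1)))" by (intro mult_left_mono) (auto simp: \<epsilon>_def)
    also have "\<dots> \<le> 1 / 2" by (simp add: field_simps)
    finally show "J * \<epsilon> \<le> 1 / 2" .
  qed (use c in \<open>auto simp: \<epsilon>_def\<close>)
  obtain D where D: "\<And>n::nat. n > 0 \<Longrightarrow> \<exists>g :: nat \<times> nat \<Rightarrow> nat.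
    g ` ({..<n} \<times> {..<D}) \<subseteq> {..<n} \<and>
    (\<forall>A Y. A \<subseteq> {..<n} \<longrightarrow> Y \<subseteq> {..<n} \<longrightarrow> \<epsilon> * n \<le> card A \<longrightarrow> \<epsilon> * n \<le> card Y \<longrightarrow>
      g ` (A \<times> {..<D}) \<inter> Y \<noteq> {})"
    using exists_mixing_maps[OF \<epsilon>(1,2)] by blast
  \<comment> \<open>Once \<open>2 * D \<le> c * M\<close>, at most \<open>c * n / 2\<close> vertices
    have load above \<open>M\<close>, as the total load is \<open>n * D\<close>. Adding 1 makes
    \<open>M\<close> positive.\<close>
  obtain M' :: nat where M': "2 * D / c \<le> M'" using real_arch_simple by blast
  define M where "M = M' + 1"
  have M: "M > 0" "2 * D \<le> c * M"
  proof -
    have "2 * D \<le> c * M'" using M' c by (simp add: field_simps)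
    also have "\<dots> \<le> c * M" using c by (simp add: M_def)
    finally show "2 * D \<le> c * M" .
  qed (simp add: M_def)
  have "\<exists>T :: nat \<Rightarrow> nat set.
    (\<forall>v<n. T v \<subseteq> {..<n} \<and> card (T v) \<le> D) \<and> (\<forall>u. card {v\<in>{..<n}. u \<in> T v} \<le> M) \<and>
    (\<forall>Y. (\<forall>j<J. Y j \<subseteq> {..<n} \<and> c * n \<le> card (Y j)) \<longrightarrow>
       n \<le> 2 * card {v\<in>{..<n}. \<forall>j<J. T v \<inter> Y j \<noteq> {}})" if n: "n > 0" for n :: nat
  proof -
    obtain g :: "nat \<times> nat \<Rightarrow> nat" where g: "g ` ({..<n} \<times> {..<D}) \<subseteq> {..<n}"
      "\<And>A Y. A \<subseteq> {..<n} \<Longrightarrow> Y \<subseteq> {..<n} \<Longrightarrow> \<epsilon> * n \<le> card A \<Longrightarrow> \<epsilon> * n \<le> card Y \<Longrightarrow>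
        g ` (A \<times> {..<D}) \<inter> Y \<noteq> {}"
      using D[OF n] by metis
    define fib where "fib u = {p\<in>{..<n} \<times> {..<D}. g p = u}" for u
    define R where "R = {u\<in>{..<n}. card (fib u) > M}"
    define T where "T v = g ` ({v} \<times> {..<D}) - R" for v
    have fib: "finite (fib u)" for u by (simp add: fib_def)
    have "M * card R \<le> (\<Sum>u\<in>R. card (fib u))"
      using sum_bounded_below[of R M "\<lambda>u. card (fib u)"] by (simp add: R_def mult.commute)
    also have "\<dots> = card (\<Union>u\<in>R. fib u)"
      by (subst card_UN_disjoint) (auto simp: R_def fib_def)
    also have "\<dots> \<le> card ({..<n} \<times> {..<D})"
      by (intro card_mono) (auto simp: fib_def)
    finally have "M * card R \<le> n * D" by (simp add: card_cartesian_product)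
    then have "real M * card R \<le> real n * D" by (metis of_nat_le_iff of_nat_mult)
    also have "2 * (real n * D) \<le> n * (c * M)"
      using mult_left_mono[OF M(2), of "real n"] by simp
    ultimately have "real M * (2 * card R) \<le> real M * (c * n)"
      by (simp add: mult.commute mult.left_commute)
    then have R: "card R \<le> c * n / 2" using M(1) by simp
    have "card (T v) \<le> D" for v
    proof -
      have "card (T v) \<le> card (g ` ({v} \<times> {..<D}))" unfolding T_def by (intro card_mono) auto
      also have "\<dots> \<le> card ({v} \<times> {..<D})" by (intro card_image_le) auto
      finally show ?thesis by (simp add: card_cartesian_product)
    qed
    moreover have "T v \<subseteq> {..<n}" if "v < n" for v
      using g(1) that by (auto simp: T_def)
    moreover have "card {v\<in>{..<n}. u \<in> T v} \<le> M" for u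
    proof (cases "{v\<in>{..<n}. u \<in> T v} = {}")
      case True
      then show ?thesis by (metis card.empty le0)
    next
      case False
      then have "u < n" "u \<notin> R" using g(1) by (auto simp: T_def)
      then have "card (fib u) \<le> M" by (simp add: R_def)
      moreover have "{v\<in>{..<n}. u \<in> T v} \<subseteq> fst ` fib u" by (force simp: T_def fib_def)
      then have "card {v\<in>{..<n}. u \<in> T v} \<le> card (fst ` fib u)" by (simp add: card_mono fib)
      moreover have "card (fst ` fib u) \<le> card (fib u)" by (simp add: card_image_le fib)
      ultimately show ?thesis by linarith
    qed
    moreover have "n \<le> 2 * card {v\<in>{..<n}. \<forall>j<J. T v \<inter> Y j \<noteq> {}}"
      if Y: "\<forall>j<J. Y j \<subseteq> {..<n} \<and> c * n \<le> card (Y j)" for Y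
    proof -
      define N where "N j = {v\<in>{..<n}. T v \<inter> Y j = {}}" for j
      define G where "G = {v\<in>{..<n}. \<forall>j<J. T v \<inter> Y j \<noteq> {}}"
      \<comment> \<open>If too many vertices missed \<open>Y j\<close>, mixing would send one of
        them into \<open>Y j - R\<close>, hence put an element of \<open>Y j\<close> into its
        \<open>T v\<close>.\<close>
      have N: "card (N j) \<le> \<epsilon> * n" if j: "j < J" for j
      proof (rule ccontr)
        assume "\<not> card (N j) \<le> \<epsilon> * n"
        moreover have "\<epsilon> * n \<le> card (Y j - R)"
        proof -
          have "\<epsilon> * n \<le> c * n / 2" using \<epsilon>(3) mult_right_mono[of \<epsilon> "c / 2" "real n"] by simp
          also have "\<dots> \<le> real (card (Y j)) - card R" using R Y j by force
          also have "\<dots> \<le> card (Y j - R)"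
            using diff_card_le_card_Diff[of R "Y j"] by (simp add: R_def)
          finally show ?thesis .
        qed
        ultimately have "g ` (N j \<times> {..<D}) \<inter> (Y j - R) \<noteq> {}"
          using Y j by (intro g(2)) (auto simp: N_def)
        then show False by (auto simp: N_def T_def)
      qed
      have "{..<n} \<subseteq> G \<union> (\<Union>j<J. N j)" by (auto simp: G_def N_def)
      then have "card {..<n} \<le> card (G \<union> (\<Union>j<J. N j))"
        by (intro card_mono) (auto simp: G_def N_def)
      also have "\<dots> \<le> card G + card (\<Union>j<J. N j)" by (rule card_Un_le)
      also have "card (\<Union>j<J. N j) \<le> (\<Sum>j<J. card (N j))" by (rule card_UN_le) simp
      finally have "real n \<le> card G + (\<Sum>j<J. real (card (N j)))"
        by (simp flip: of_nat_sum of_nat_add)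
      also have "(\<Sum>j<J. real (card (N j))) \<le> J * \<epsilon> * n"
        using sum_bounded_above[of "{..<J}" "\<lambda>j. real (card (N j))" "\<epsilon> * n"] N by simp
      also have "\<dots> \<le> n / 2" using mult_right_mono[OF \<epsilon>(4), of "real n"] by simp
      finally show ?thesis by (simp add: G_def)
    qed
    ultimately show ?thesis by blast
  qed
  with M(1) show ?thesis by blast
qed

section \<open>Bounded degree hypergraphs with overlap\<close>

text \<open>The edges are the \<open>r\<close>-subsets of the neighbourhoods \<open>T v\<close>. The
  number of vertices is a multiple of \<open>r\<close> so that they split into \<open>r\<close>
  equal blocks.\<close>

lemma exists_bounded_degree_overlap:
  fixes r :: nat
  defines "r \<equiv> DIM('a::euclidean_space) + 1"
  shows "\<exists>(\<delta>::real) (k::nat). \<delta> > 0 \<and> k > 0 \<and> (\<forall>m>0. \<exists>E :: nat set set.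
    uniform_hypergraph r \<lparr>verts = {..<r * m}, hyperedges = E\<rparr> \<and>
    (\<forall>v. hyperdegree \<lparr>verts = {..<r * m}, hyperedges = E\<rparr> v \<le> k) \<and>
    (\<forall>f :: nat \<Rightarrow> 'a. \<exists>p. \<delta> * (r * m) \<le> overlap_count \<lparr>verts = {..<r * m}, hyperedges = E\<rparr> f p))"
proof -
  obtain K :: nat and c :: real where "c > 0" and center: "\<forall>(I::nat set) (x :: nat \<Rightarrow> 'a).
     finite I \<longrightarrow> (\<exists>z Y. (\<forall>j<K. Y j \<subseteq> I \<and> c * card I \<le> card (Y j)) \<and>
       (\<forall>y. (\<forall>j<K. y j \<in> Y j) \<longrightarrow> z \<in> convex hull (x ` y ` {..<K})))"
    using homogeneous_center[where 'i=nat and 'a='a] by (elim exE conjE)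
  have r: "r > 0" by (simp add: r_def)
  \<comment> \<open>A block has density \<open>1 / r\<close>; the sets to be hit are the
    \<open>K\<close> sets around the center and the \<open>r\<close> blocks.\<close>
  define c' where "c' = min c (1 / r)"
  have c': "0 < c'" "c' \<le> 1" "c' \<le> c" "c' * r \<le> 1"
  proof -
    show "c' \<le> 1" using r by (simp add: c'_def min_le_iff_disj)
    have "c' * r \<le> (1 / r) * r" by (intro mult_right_mono) (auto simp: c'_def)
    then show "c' * r \<le> 1" using r by simp
  qed (use r \<open>c > 0\<close> in \<open>auto simp: c'_def\<close>)
  obtain D M :: nat where M: "M > 0" and hit: "\<And>n::nat. n > 0 \<Longrightarrow> \<exists>T :: nat \<Rightarrow> nat set.
    (\<forall>v<n. T v \<subseteq> {..<n} \<and> card (T v) \<le> D) \<and> (\<forall>u. card {v\<in>{..<n}. u \<in> T v} \<le> M) \<and>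
    (\<forall>Y. (\<forall>j<K + r. Y j \<subseteq> {..<n} \<and> c' * n \<le> card (Y j)) \<longrightarrow>
       n \<le> 2 * card {v\<in>{..<n}. \<forall>j<K + r. T v \<inter> Y j \<noteq> {}})"
    using exists_hitting_neighbourhoods[OF c'(1,2), of "K + r"] by blast
  define k where "k = M * 2 ^ D"
  \<comment> \<open>At least half of the vertices yield an edge through \<open>z\<close>, and each
    edge arises from at most \<open>M\<close> of them.\<close>
  define \<delta> where "\<delta> = 1 / (2 * real M)"
  have "\<exists>E :: nat set set.
    uniform_hypergraph r \<lparr>verts = {..<r * m}, hyperedges = E\<rparr> \<and>
    (\<forall>v. hyperdegree \<lparr>verts = {..<r * m}, hyperedges = E\<rparr> v \<le> k) \<and>
    (\<forall>f :: nat \<Rightarrow> 'a. \<exists>p. \<delta> * (r * m) \<le> overlap_count \<lparr>verts = {..<r * m}, hyperedges = E\<rparr> f p)"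
    if m: "m > 0" for m
  proof -
    define n where "n = r * m"
    have "n > 0" using m r by (simp add: n_def)
    from hit[OF this] obtain T where T: "\<And>v. v < n \<Longrightarrow> T v \<subseteq> {..<n}" "\<And>v. v < n \<Longrightarrow> card (T v) \<le> D"
      and deg: "\<And>u. card {v\<in>{..<n}. u \<in> T v} \<le> M"
      and many: "\<And>Y. (\<forall>j<K + r. Y j \<subseteq> {..<n} \<and> c' * n \<le> card (Y j)) \<Longrightarrow>
       n \<le> 2 * card {v\<in>{..<n}. \<forall>j<K + r. T v \<inter> Y j \<noteq> {}}" by blast
    have finT: "finite (T v)" if "v < n" for v using T(1)[OF that] finite_subset by blast
    define E where "E = {e. card e = r \<and> (\<exists>v<n. e \<subseteq> T v)}"
    have E: "e \<subseteq> {..<n}" if "e \<in> E" for e using that T(1) by (force simp: E_def)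
    then have finE: "finite E" by (intro finite_subset[of E "Pow {..<n}"]) auto
    have "uniform_hypergraph r \<lparr>verts = {..<n}, hyperedges = E\<rparr>"
      using E by (auto simp: uniform_hypergraph_def E_def)
    moreover have "hyperdegree \<lparr>verts = {..<n}, hyperedges = E\<rparr> u \<le> k" for u
    proof -
      let ?N = "{v\<in>{..<n}. u \<in> T v}"
      have "card {e\<in>E. u \<in> e} \<le> card (\<Union>v\<in>?N. Pow (T v))"
        using finT by (intro card_mono) (auto simp: E_def)
      also have "\<dots> \<le> (\<Sum>v\<in>?N. card (Pow (T v)))" by (rule card_UN_le) simp
      also have "\<dots> \<le> (\<Sum>v\<in>?N. 2 ^ D)"
        using T(2) finT by (intro sum_mono) (simp add: card_Pow)
      also have "\<dots> \<le> k" using deg[of u] by (simp add: k_def)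
      finally show ?thesis by (simp add: hyperdegree_def)
    qed
    moreover have "\<exists>p. \<delta> * n \<le> overlap_count \<lparr>verts = {..<n}, hyperedges = E\<rparr> f p"
      for f :: "nat \<Rightarrow> 'a"
    proof -
      obtain z Y where Y: "\<And>j. j < K \<Longrightarrow> Y j \<subseteq> {..<n}" "\<And>j. j < K \<Longrightarrow> c * n \<le> card (Y j)"
        and z: "\<And>y. (\<forall>j<K. y j \<in> Y j) \<Longrightarrow> z \<in> convex hull (f ` y ` {..<K})"
        using center[rule_format, of "{..<n}" f] by auto
      define block where "block i = {i * m..<i * m + m}" for i
      \<comment> \<open>Meeting the \<open>r\<close> disjoint blocks forces a neighbourhood to have at least \<open>r\<close> elements.\<close>
      define Y' where "Y' j = (if j < K then Y j else block (j - K))" for j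
      define G where "G = {v\<in>{..<n}. \<forall>j<K + r. T v \<inter> Y' j \<noteq> {}}"
      have "Y' j \<subseteq> {..<n} \<and> c' * n \<le> card (Y' j)" if j: "j < K + r" for j
      proof (cases "j < K")
        case True
        have "c' * n \<le> c * n" using c' by (simp add: mult_right_mono)
        then show ?thesis using True Y[OF True] by (simp add: Y'_def)
      next
        case False
        then have "Suc (j - K) \<le> r" using j by simp
        then have "Suc (j - K) * m \<le> n" unfolding n_def by (rule mult_le_mono1)
        moreover have "c' * n \<le> m" using mult_right_mono[OF c'(4), of "real m"] by (simp add: n_def)
        ultimately show ?thesis using False by (auto simp: Y'_def block_def)
      qed
      then have G: "n \<le> 2 * card G" unfolding G_def by (intro many) blast
      have "\<exists>e\<in>E. e \<subseteq> T v \<and> z \<in> convex hull (f ` e)" if v: "v \<in> G" for v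
      proof -
        have "v < n" using v by (simp add: G_def)
        have "\<forall>i<r. \<exists>t. t \<in> T v \<and> t \<in> block i"
        proof (intro allI impI)
          fix i assume "i < r"
          then have "T v \<inter> Y' (K + i) \<noteq> {}" using v by (simp add: G_def)
          then show "\<exists>t. t \<in> T v \<and> t \<in> block i" by (auto simp: Y'_def)
        qed
        then obtain t where t: "\<And>i. i < r \<Longrightarrow> t i \<in> T v \<and> t i \<in> block i" by metis
        have "t i div m = i" if "i < r" for i
          using t[OF that] by (auto simp: block_def mult.commute intro!: div_nat_eqI)
        then have "inj_on t {..<r}" by (metis inj_onI lessThan_iff)
        then have "r \<le> card (T v)"
          using t finT[OF \<open>v < n\<close>] card_inj_on_le[of t "{..<r}" "T v"] by auto
        have "\<forall>j<K. \<exists>y. y \<in> T v \<and> y \<in> Y j"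
        proof (intro allI impI)
          fix j assume "j < K"
          then have "T v \<inter> Y' j \<noteq> {}" using v by (simp add: G_def)
          then show "\<exists>y. y \<in> T v \<and> y \<in> Y j" using \<open>j < K\<close> by (auto simp: Y'_def)
        qed
        then obtain y where y: "\<And>j. j < K \<Longrightarrow> y j \<in> T v \<and> y j \<in> Y j" by metis
        then have "z \<in> convex hull (f ` y ` {..<K})" using z by blast
        \<comment> \<open>Caratheodory in dimension \<open>r - 1\<close> gives at most
          \<open>r\<close> image points. As \<open>f\<close> may identify vertices, \<open>V\<close>
          takes one preimage of each; extending \<open>V\<close> within \<open>T v\<close> to an
          edge only enlarges the hull.\<close>
        then obtain F where F: "F \<subseteq> f ` y ` {..<K}" "card F \<le> r" "z \<in> convex hull F"
          unfolding caratheodory[of "f ` y ` {..<K}"] r_def by blast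
        then obtain V where V: "V \<subseteq> y ` {..<K}" "inj_on f V" "F = f ` V"
          by (auto simp: subset_image_inj)
        then have "card V \<le> r" using F by (simp add: card_image)
        moreover have "V \<subseteq> T v" using V y by auto
        ultimately obtain e where e: "V \<subseteq> e" "e \<subseteq> T v" "card e = r"
          using exists_subset_between[of V r "T v"] \<open>r \<le> card (T v)\<close> finT[OF \<open>v < n\<close>] by blast
        have "z \<in> convex hull (f ` e)"
          using F(3) V(3) e(1) hull_mono[of F "f ` e" convex] by blast
        with e \<open>v < n\<close> show ?thesis by (auto simp: E_def)
      qed
      then obtain h where h: "\<And>v. v \<in> G \<Longrightarrow> h v \<in> E \<and> h v \<subseteq> T v \<and> z \<in> convex hull (f ` h v)"
        by metis
      define Q where "Q = {e\<in>E. z \<in> convex hull (f ` e)}"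
      have "finite Q" using finE by (simp add: Q_def)
      have "G \<subseteq> (\<Union>e\<in>Q. {v\<in>G. h v = e})" using h by (auto simp: Q_def)
      then have "card G \<le> card (\<Union>e\<in>Q. {v\<in>G. h v = e})"
        using \<open>finite Q\<close> by (intro card_mono) (auto simp: G_def)
      also have "\<dots> \<le> (\<Sum>e\<in>Q. card {v\<in>G. h v = e})" by (rule card_UN_le) fact
      \<comment> \<open>If \<open>h v = e\<close>, then \<open>T v\<close> contains any fixed vertex
        of \<open>e\<close>, which happens for at most \<open>M\<close> values of
        \<open>v\<close>.\<close>
      also have "\<dots> \<le> (\<Sum>e\<in>Q. M)"
      proof (rule sum_mono)
        fix e assume "e \<in> Q"
        then have "e \<noteq> {}" using r by (auto simp: Q_def E_def)
        then obtain u where u: "u \<in> e" by blast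
        have "card {v\<in>G. h v = e} \<le> card {v\<in>{..<n}. u \<in> T v}"
          using h u by (intro card_mono) (auto simp: G_def)
        then show "card {v\<in>G. h v = e} \<le> M" using deg[of u] by linarith
      qed
      finally have "card G \<le> card Q * M" by simp
      with G have "n \<le> 2 * (card Q * M)" by linarith
      then have "real n \<le> 2 * (card Q * real M)"
        by (metis of_nat_le_iff of_nat_mult of_nat_numeral)
      then have "\<delta> * n \<le> card Q" using M by (simp add: \<delta>_def field_simps)
      then show ?thesis by (intro exI[of _ z]) (simp add: overlap_count_def Q_def)
    qed
    ultimately show ?thesis unfolding n_def by blast
  qed
  moreover have "\<delta> > 0" "k > 0" using M by (auto simp: \<delta>_def k_def)
  ultimately show ?thesis by blast
qed

section \<open>Regularization\<close>

lemma card_hyperedges_le: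
  assumes "uniform_hypergraph r H" "r > 0" "\<And>v. v \<in> verts H \<Longrightarrow> hyperdegree H v \<le> k"
  shows "card (hyperedges H) \<le> card (verts H) * k"
proof -
  have fin: "finite (verts H)" and sub: "\<And>e. e \<in> hyperedges H \<Longrightarrow> e \<subseteq> verts H \<and> e \<noteq> {}"
    using assms(1,2) by (auto simp: uniform_hypergraph_def)
  have finE: "finite (hyperedges H)"
    using fin sub by (intro finite_subset[of "hyperedges H" "Pow (verts H)"]) auto
  have "hyperedges H \<subseteq> (\<Union>v\<in>verts H. {e\<in>hyperedges H. v \<in> e})" using sub by fastforce
  then have "card (hyperedges H) \<le> card (\<Union>v\<in>verts H. {e\<in>hyperedges H. v \<in> e})"
    using fin finE by (intro card_mono) auto
  also have "\<dots> \<le> (\<Sum>v\<in>verts H. hyperdegree H v)"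
    unfolding hyperdegree_def by (rule card_UN_le[OF fin])
  also have "\<dots> \<le> (\<Sum>v\<in>verts H. k)" using assms(3) by (rule sum_mono)
  finally show ?thesis by simp
qed

section \<open>Relabelling the vertices along an injection\<close>

definition map_hypergraph :: "('a \<Rightarrow> 'b) \<Rightarrow> 'a hypergraph \<Rightarrow> 'b hypergraph" where
  "map_hypergraph \<phi> H = \<lparr>verts = \<phi> ` verts H, hyperedges = (`) \<phi> ` hyperedges H\<rparr>"

context
  fixes \<phi> :: "'a \<Rightarrow> 'b"
  assumes inj: "inj \<phi>"
begin

lemma inj_on_image_sets: "inj_on ((`) \<phi>) X"
  using inj by (simp add: inj_on_def inj_image_eq_iff)

lemma card_verts_map_hypergraph: "card (verts (map_hypergraph \<phi> H)) = card (verts H)"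
  using inj by (simp add: map_hypergraph_def card_image inj_on_subset)

lemma card_hyperedges_map_hypergraph: "card (hyperedges (map_hypergraph \<phi> H)) = card (hyperedges H)"
  by (simp add: map_hypergraph_def card_image inj_on_image_sets)

lemma uniform_map_hypergraph: "uniform_hypergraph r H \<Longrightarrow> uniform_hypergraph r (map_hypergraph \<phi> H)"
  using inj by (auto simp: uniform_hypergraph_def map_hypergraph_def card_image inj_on_subset)

lemma hyperdegree_map_hypergraph: "hyperdegree (map_hypergraph \<phi> H) (\<phi> v) = hyperdegree H v"
proof -
  have "{e \<in> (`) \<phi> ` hyperedges H. \<phi> v \<in> e} = (`) \<phi> ` {e \<in> hyperedges H. v \<in> e}"
    using inj by (auto simp: inj_eq)
  then show ?thesis
    by (simp add: hyperdegree_def map_hypergraph_def card_image inj_on_image_sets)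
qed

lemma overlap_count_map_hypergraph:
  "overlap_count (map_hypergraph \<phi> H) f p = overlap_count H (f \<circ> \<phi>) p"
proof -
  have "{e \<in> (`) \<phi> ` hyperedges H. p \<in> convex hull (f ` e)}
      = (`) \<phi> ` {e \<in> hyperedges H. p \<in> convex hull ((f \<circ> \<phi>) ` e)}"
    by (auto simp: image_comp)
  then show ?thesis
    by (simp add: overlap_count_def map_hypergraph_def card_image inj_on_image_sets)
qed

end

section \<open>Making a hypergraph regular by matchings in a grid\<close>

text \<open>Addition modulo \<open>k\<close>; for arguments below \<open>k\<close> one subtraction
  suffices.\<close>

definition cyc_add :: "nat \<Rightarrow> nat \<Rightarrow> nat \<Rightarrow> nat" where
  "cyc_add k j t = (if j + t < k then j + t else j + t - k)"

text \<open>A choice of one cell per row of an \<open>r\<close> by \<open>k\<close> grid. Leaving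
  row 0 unshifted lets the shift \<open>t\<close> be read off from the set.\<close>

definition shifted_column :: "nat \<Rightarrow> nat \<Rightarrow> nat \<Rightarrow> nat \<Rightarrow> (nat \<times> nat) set" where
  "shifted_column r k t j = (\<lambda>i. (i, if i = 0 then j else cyc_add k j t)) ` {..<r}"

text \<open>Every fibre \<open>{v} \<times> {..<r} \<times> {..<k}\<close> carries, for each shift \<open>t\<close>, a perfect matching by shifted
  columns; enough shifts are used to raise the degree of the copies of \<open>v\<close> to exactly \<open>k\<close>.\<close>

definition regularization :: "nat \<Rightarrow> nat \<Rightarrow> 'v hypergraph \<Rightarrow> ('v \<times> nat \<times> nat) hypergraph" where
  "regularization r k H = \<lparr>verts = verts H \<times> ({..<r} \<times> {..<k}),
     hyperedges = (\<lambda>(e, w). e \<times> {w}) ` (hyperedges H \<times> ({..<r} \<times> {..<k})) \<union>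
       (\<Union>v\<in>verts H. \<Union>t<k - hyperdegree H v. \<Union>j<k. {{v} \<times> shifted_column r k t j})\<rparr>"

lemma copy_mem_regularization:
  assumes "e \<in> hyperedges H" "w \<in> {..<r} \<times> {..<k}"
  shows "e \<times> {w} \<in> hyperedges (regularization r k H)"
proof -
  have "e \<times> {w} \<in> (\<lambda>(e, w). e \<times> {w}) ` (hyperedges H \<times> ({..<r} \<times> {..<k}))"
    using assms by (intro image_eqI[of _ _ "(e, w)"]) auto
  then show ?thesis by (simp add: regularization_def)
qed

lemma card_shifted_column: "card (shifted_column r k t j) = r"
  unfolding shifted_column_def by (subst card_image) (auto intro: inj_onI)

lemma shifted_column_subset: "t < k \<Longrightarrow> j < k \<Longrightarrow> shifted_column r k t j \<subseteq> {..<r} \<times> {..<k}"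
  by (auto simp: shifted_column_def cyc_add_def)

lemma mem_shifted_column:
  "(i, y) \<in> shifted_column r k t j \<longleftrightarrow> i < r \<and> y = (if i = 0 then j else cyc_add k j t)"
  by (auto simp: shifted_column_def)

text \<open>Row 0 shows \<open>j\<close> and row 1 shows \<open>j + t\<close> modulo
  \<open>k\<close>; \<open>r \<ge> 2\<close> provides both rows.\<close>

lemma shifted_column_shift_eq:
  assumes "shifted_column r k t j = shifted_column r k t' j'" "r \<ge> 2" "t < k" "t' < k" "j < k"
  shows "t = t'"
proof -
  have "(0, j) \<in> shifted_column r k t j" "(1, cyc_add k j t) \<in> shifted_column r k t j"
    using assms(2) by (auto simp: mem_shifted_column)
  then have "j = j'" "cyc_add k j t = cyc_add k j' t'"
    unfolding assms(1) by (auto simp: mem_shifted_column)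
  then show ?thesis using assms(3-5) by (auto simp: cyc_add_def split: if_splits)
qed

text \<open>Shifting modulo \<open>k\<close> permutes each row, so for a fixed shift the columns
  partition the grid.\<close>

lemma ex1_shifted_column:
  assumes "i < r" "y < k" "t < k"
  shows "\<exists>!j. j < k \<and> (i, y) \<in> shifted_column r k t j"
proof (cases "i = 0")
  case True
  then show ?thesis using assms by (auto simp: mem_shifted_column)
next
  case False
  show ?thesis
  proof (rule ex1I[of _ "if t \<le> y then y - t else y + k - t"])
    fix j assume "j < k \<and> (i, y) \<in> shifted_column r k t j"
    then show "j = (if t \<le> y then y - t else y + k - t)"
      using False assms by (auto simp: mem_shifted_column cyc_add_def split: if_splits)
  qed (use False assms in \<open>auto simp: mem_shifted_column cyc_add_def split: if_splits\<close>)
qed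

context
  fixes r k :: nat and H :: "'v hypergraph"
  assumes unif: "uniform_hypergraph r H" and r: "r \<ge> 2"
    and deg: "\<And>v. v \<in> verts H \<Longrightarrow> hyperdegree H v \<le> k"
begin

lemma uniform_regularization: "uniform_hypergraph r (regularization r k H)"
proof -
  have "e \<subseteq> verts H \<times> ({..<r} \<times> {..<k}) \<and> card e = r"
    if "e \<in> hyperedges (regularization r k H)" for e
  proof -
    from that consider e' w where "e' \<in> hyperedges H" "w \<in> {..<r} \<times> {..<k}" "e = e' \<times> {w}"
      | v t j where "v \<in> verts H" "t < k - hyperdegree H v" "j < k" "e = {v} \<times> shifted_column r k t j"
      unfolding regularization_def hypergraph.simps by (elim UnE imageE UN_E SigmaE) auto
    then show ?thesis
    proof cases
      case 1
      then have "e' \<subseteq> verts H" "card e' = r" using unif by (auto simp: uniform_hypergraph_def)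
      with 1 show ?thesis by (auto simp: card_cartesian_product)
    next
      case 2
      then show ?thesis
        using shifted_column_subset[of t k j r] less_le_trans[OF 2(2) diff_le_self]
        by (auto simp: card_cartesian_product card_shifted_column)
    qed
  qed
  moreover have "verts (regularization r k H) = verts H \<times> ({..<r} \<times> {..<k})"
    by (simp add: regularization_def)
  ultimately show ?thesis using unif by (simp add: uniform_hypergraph_def)
qed

text \<open>The vertex lies on one copy of each edge of \<open>H\<close> at \<open>v\<close> and,
  for each of the \<open>k - hyperdegree H v\<close> shifts, on exactly one column.\<close>

lemma hyperdegree_regularization:
  assumes v: "v \<in> verts H" and w: "i < r" "y < k"
  shows "hyperdegree (regularization r k H) (v, i, y) = k"
proof -
  define col where "col t = (THE j. j < k \<and> (i, y) \<in> shifted_column r k t j)" for t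
  have col: "j < k \<and> (i, y) \<in> shifted_column r k t j \<longleftrightarrow> j = col t" if "t < k" for t j
    using the1_equality[OF ex1_shifted_column[OF w that]] theI'[OF ex1_shifted_column[OF w that]]
    unfolding col_def by blast
  define A where "A = (\<lambda>e. e \<times> {(i, y)}) ` {e \<in> hyperedges H. v \<in> e}"
  define B where "B = (\<lambda>t. {v} \<times> shifted_column r k t (col t)) ` {..<k - hyperdegree H v}"
  have finV: "finite (verts H)" and E: "\<And>e. e \<in> hyperedges H \<Longrightarrow> e \<subseteq> verts H \<and> card e = r"
    using unif by (auto simp: uniform_hypergraph_def)
  have finE: "finite (hyperedges H)"
    using finV E by (intro finite_subset[of "hyperedges H" "Pow (verts H)"]) auto
  have "{e \<in> hyperedges (regularization r k H). (v, i, y) \<in> e} = A \<union> B" (is "?L = _")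
  proof
    show "?L \<subseteq> A \<union> B"
    proof
      fix e assume "e \<in> ?L"
      then consider e' where "e' \<in> hyperedges H" "v \<in> e'" "e = e' \<times> {(i, y)}"
        | t j where "t < k - hyperdegree H v" "j < k" "e = {v} \<times> shifted_column r k t j"
            "(i, y) \<in> shifted_column r k t j"
        by (auto simp: regularization_def)
      then show "e \<in> A \<union> B"
      proof cases
        case 1
        then show ?thesis by (auto simp: A_def)
      next
        case 2
        then have "j = col t" using col[of t j] by simp
        with 2 show ?thesis by (auto simp: B_def)
      qed
    qed
    have "A \<subseteq> ?L" using w by (auto simp: A_def intro!: copy_mem_regularization)
    moreover have "B \<subseteq> ?L"
    proof
      fix e assume "e \<in> B"
      then obtain t where t: "t < k - hyperdegree H v" "e = {v} \<times> shifted_column r k t (col t)"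
        by (auto simp: B_def)
      then have "col t < k" "(i, y) \<in> shifted_column r k t (col t)" using col[of t "col t"] by auto
      with t v show "e \<in> ?L" by (auto simp: regularization_def)
    qed
    ultimately show "A \<union> B \<subseteq> ?L" by blast
  qed
  moreover have "card A = hyperdegree H v"
    unfolding A_def hyperdegree_def by (intro card_image inj_onI) auto
  moreover have "card B = k - hyperdegree H v"
  proof -
    have "inj_on (\<lambda>t. {v} \<times> shifted_column r k t (col t)) {..<k - hyperdegree H v}"
    proof (rule inj_onI)
      fix t t' assume t: "t \<in> {..<k - hyperdegree H v}" "t' \<in> {..<k - hyperdegree H v}"
        and "{v} \<times> shifted_column r k t (col t) = {v} \<times> shifted_column r k t' (col t')"
      then have "shifted_column r k t (col t) = shifted_column r k t' (col t')" by auto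
      moreover have "col t < k" using col[of t "col t"] t by auto
      ultimately show "t = t'" using shifted_column_shift_eq[of r k t "col t" t' "col t'"] r t by auto
    qed
    then show ?thesis by (simp add: B_def card_image)
  qed
  moreover have "A \<inter> B = {}"
  proof -
    \<comment> \<open>A copied edge projects to \<open>r \<ge> 2\<close> vertices of
      \<open>H\<close>, a column to \<open>v\<close> alone.\<close>
    have False if "e \<times> {(i, y)} = {v} \<times> shifted_column r k t j" "e \<in> hyperedges H" for e t j
    proof -
      have "e \<subseteq> {v}" using that(1) by auto
      then have "card e \<le> 1" using card_mono[of "{v}" e] by simp
      then show False using E[OF that(2)] r by simp
    qed
    then show ?thesis by (auto simp: A_def B_def)
  qed
  moreover have "finite A" "finite B" using finE by (auto simp: A_def B_def)
  ultimately show ?thesis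
    using deg[OF v] by (simp add: hyperdegree_def[of "regularization r k H"] card_Un_disjoint)
qed

text \<open>The copy of \<open>H\<close> at \<open>(0, 0)\<close> alone gives the bound;
  \<open>k > 0\<close> ensures that it exists.\<close>

lemma overlap_count_regularization:
  assumes "k > 0"
  shows "overlap_count H (\<lambda>v. f (v, 0, 0)) p \<le> overlap_count (regularization r k H) f p"
proof -
  let ?g = "\<lambda>e. e \<times> {(0::nat, 0::nat)}"
  have "finite (verts (regularization r k H))"
      "hyperedges (regularization r k H) \<subseteq> Pow (verts (regularization r k H))"
    using uniform_regularization by (auto simp: uniform_hypergraph_def)
  then have fin: "finite (hyperedges (regularization r k H))"
    using finite_subset by blast
  have "f ` ?g e = (\<lambda>v. f (v, 0, 0)) ` e" for e by force
  then have "?g ` {e \<in> hyperedges H. p \<in> convex hull ((\<lambda>v. f (v, 0, 0)) ` e)}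
      \<subseteq> {e \<in> hyperedges (regularization r k H). p \<in> convex hull (f ` e)}"
    using assms r by (auto intro!: copy_mem_regularization)
  moreover have "inj_on ?g X" for X by (rule inj_on_inverseI[of _ "(`) fst"]) simp
  ultimately show ?thesis
    unfolding overlap_count_def using fin by (intro card_inj_on_le[of ?g]) auto
qed

end

section \<open>Assembly of the regular hypergraphs on natural numbers\<close>

theorem theorem1p5:
  assumes "CARD('d::finite) \<ge> 2"
  shows "\<exists>c::real. c > 0 \<and> (\<exists>k::nat. k > 0 \<and>
    (\<exists>(N::nat set) (H::nat \<Rightarrow> nat hypergraph). infinite N \<and>
      (\<forall>n\<in>N.
        uniform_hypergraph (CARD('d) + 1) (H n) \<and>
        card (verts (H n)) = n \<and>
        (\<forall>v\<in>verts (H n). hyperdegree (H n) v = k) \<and>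
        (\<forall>f::nat \<Rightarrow> real ^ 'd. inj_on f (verts (H n)) \<longrightarrow>
          (\<exists>p::real ^ 'd.
            real (overlap_count (H n) f p) \<ge> c * real (card (hyperedges (H n))))))))"
proof -
  define r where "r = CARD('d) + 1"
  have r: "r \<ge> 2" using assms by (simp add: r_def)
  have DIM: "DIM(real ^ 'd) + 1 = r" by (simp add: r_def)
  obtain \<delta> :: real and k :: nat where \<delta>: "\<delta> > 0" and k: "k > 0" and base: "\<forall>m>0. \<exists>E :: nat set set.
    uniform_hypergraph r \<lparr>verts = {..<r * m}, hyperedges = E\<rparr> \<and>
    (\<forall>v. hyperdegree \<lparr>verts = {..<r * m}, hyperedges = E\<rparr> v \<le> k) \<and>
    (\<forall>f :: nat \<Rightarrow> real ^ 'd. \<exists>p. \<delta> * (r * m) \<le> overlap_count \<lparr>verts = {..<r * m}, hyperedges = E\<rparr> f p)"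
    using exists_bounded_degree_overlap[where 'a="real ^ 'd", unfolded DIM] by (elim exE conjE)
  \<comment> \<open>\<open>r * m\<close> base vertices with \<open>r * k\<close> copies each make
    \<open>s * m\<close> vertices.\<close>
  define s where "s = r * (r * k)"
  have s: "s > 0" using r k by (simp add: s_def)
  \<comment> \<open>A \<open>k\<close>-regular hypergraph on \<open>s * m\<close> vertices has at
    most \<open>s * m * k = r * m * (r * k * k)\<close> edges, and at least
    \<open>\<delta> * (r * m)\<close> simplices will contain the point.\<close>
  define c where "c = \<delta> / (r * k * k)"
  define good where "good n G \<longleftrightarrow> uniform_hypergraph r G \<and> card (verts G) = n \<and>
        (\<forall>v\<in>verts G. hyperdegree G v = k) \<and>
        (\<forall>f::nat \<Rightarrow> real ^ 'd. \<exists>p. c * real (card (hyperedges G)) \<le> real (overlap_count G f p))"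
    for n and G :: "nat hypergraph"
  have "\<exists>G. good (s * m) G" if "m > 0" for m
  proof -
    obtain E :: "nat set set" where unif: "uniform_hypergraph r \<lparr>verts = {..<r * m}, hyperedges = E\<rparr>"
      and deg: "\<And>v. hyperdegree \<lparr>verts = {..<r * m}, hyperedges = E\<rparr> v \<le> k"
      and overlap: "\<And>f :: nat \<Rightarrow> real ^ 'd. \<exists>p. \<delta> * (r * m) \<le>
        overlap_count \<lparr>verts = {..<r * m}, hyperedges = E\<rparr> f p"
      using base \<open>m > 0\<close> by blast
    define H where "H = \<lparr>verts = {..<r * m}, hyperedges = E\<rparr>"
    note H = unif[folded H_def] deg[folded H_def] overlap[folded H_def]
    define R where "R = regularization r k H"
    define G where "G = map_hypergraph (to_nat :: nat \<times> nat \<times> nat \<Rightarrow> nat) R"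
    have inj: "inj (to_nat :: nat \<times> nat \<times> nat \<Rightarrow> nat)" by simp
    have vR: "verts R = {..<r * m} \<times> ({..<r} \<times> {..<k})" by (simp add: R_def regularization_def H_def)
    have uR: "uniform_hypergraph r R"
      unfolding R_def using H(1,2) r by (intro uniform_regularization)
    have dR: "hyperdegree R w = k" if w: "w \<in> verts R" for w
    proof -
      obtain v i y where "w = (v, i, y)" "v \<in> verts H" "i < r" "y < k"
        using w by (auto simp: vR H_def)
      then show ?thesis
        unfolding R_def using hyperdegree_regularization[OF H(1) r H(2)] by blast
    qed
    have cR: "card (verts R) = s * m" by (simp add: vR s_def card_cartesian_product mult_ac)
    have "card (hyperedges R) \<le> card (verts R) * k"
      using uR dR r by (intro card_hyperedges_le) auto
    then have "real (card (hyperedges R)) \<le> real (s * m * k)"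
      unfolding cR by (rule of_nat_mono)
    then have "c * card (hyperedges R) \<le> c * real (s * m * k)"
      using \<delta> by (intro mult_left_mono) (auto simp: c_def)
    also have "\<dots> = \<delta> * (r * m)" using r k by (simp add: c_def s_def field_simps)
    finally have edges: "c * card (hyperedges R) \<le> \<delta> * (r * m)" .
    have "\<exists>p. c * real (card (hyperedges G)) \<le> real (overlap_count G f p)"
      for f :: "nat \<Rightarrow> real ^ 'd"
    proof -
      obtain p where p: "\<delta> * (r * m) \<le> overlap_count H (\<lambda>v. (f \<circ> to_nat) (v, 0::nat, 0::nat)) p"
        using H(3) by blast
      have "overlap_count H (\<lambda>v. (f \<circ> to_nat) (v, 0::nat, 0::nat)) p \<le> overlap_count R (f \<circ> to_nat) p"
        unfolding R_def using H(1,2) r k by (intro overlap_count_regularization)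
      then have "overlap_count H (\<lambda>v. (f \<circ> to_nat) (v, 0::nat, 0::nat)) p \<le> overlap_count G f p"
        by (simp add: G_def overlap_count_map_hypergraph[OF inj])
      then show ?thesis
        using p edges by (intro exI[of _ p]) (simp add: G_def card_hyperedges_map_hypergraph[OF inj])
    qed
    moreover have "\<forall>v\<in>verts G. hyperdegree G v = k"
    proof
      fix v assume "v \<in> verts G"
      then obtain w where "w \<in> verts R" "v = to_nat w" by (auto simp: G_def map_hypergraph_def)
      then show "hyperdegree G v = k"
        using dR by (simp add: G_def hyperdegree_map_hypergraph[OF inj])
    qed
    ultimately have "good (s * m) G"
      unfolding good_def using uR cR
      by (simp add: G_def uniform_map_hypergraph[OF inj] card_verts_map_hypergraph[OF inj])
    then show ?thesis by blast
  qed
  define N where "N = (\<lambda>m. s * m) ` {0<..}"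
  have "\<exists>G. good n G" if "n \<in> N" for n
    using that \<open>\<And>m. m > 0 \<Longrightarrow> \<exists>G. good (s * m) G\<close> by (auto simp: N_def)
  then obtain H where "\<And>n. n \<in> N \<Longrightarrow> good n (H n)" by metis
  moreover have "infinite N"
    unfolding N_def using s by (subst finite_image_iff) (auto intro: inj_onI simp: infinite_Ioi)
  moreover have "c > 0" using \<delta> r k by (simp add: c_def)
  ultimately show ?thesis
    unfolding good_def r_def[symmetric] using k
    by (intro exI[of _ c] conjI exI[of _ k] exI[of _ N] exI[of _ H]) blast+
qed

end
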